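(* Let $X\in L^2$ be a real random variable with atomless, nondegenerate distribution function $F$, with quantile function $Q$ and quantile risk profile $\mathcal W_X$ as in the context. Define, for every $t\in J(F)=\{t:0<F(t)<1\}$, $$\ell(t):=\mathbb E[t-X\mid X<t],\qquad r(t):=\mathbb E[X-t\mid X>t],\qquad D(t):=r(t)^2-\ell(t)^2 .$$ Then: (1) The profile $\mathcal W_X$ is locally absolutely continuous on $(0,1)$ and, for almost every $u\in(0,1)$, $$\mathcal W_X'(u)=\bigl(Q(u)-a(u)\bigr)^2-\bigl(b(u)-Q(u)\bigr)^2=\ell(Q(u))^2-r(Q(u))^2 .$$ (2) Consequently, $\mathcal W_X$ is convex if and only if $u\mapsto D(Q(u))$ has a nonincreasing representative (i.e. agrees almost everywhere on $(0,1)$ with a nonincreasing function). (3) If both $F$ and $1-F$ are log-concave on $J(F)$, then $\ell$ is nondecreasing and $r$ is nonincreasing on $J(F)$, and the condition in (2) holds, so $\mathcal W_X$ is convex. (4) If $D$ is nonincreasing and the mean $\mu=\mathbb E X$ is also a median of $X$, then $u=1/2$ minimizes $\mathcal W_X$. It is the unique minimizer whenever $D$ is strictly decreasing on the support of $X$ (where $D$ is defined).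
   Context: $Q(u)=\inf\{x:F(x)\ge u\}$. For $0<u<1$ define $$a(u):=\frac1u\int_0^u Q(v)\,dv,\qquad b(u):=\frac1{1-u}\int_u^1 Q(v)\,dv,$$ $$\mathcal W_X(u):=\int_0^u\bigl(Q(v)-a(u)\bigr)^2dv+\int_u^1\bigl(Q(v)-b(u)\bigr)^2dv,$$ and $\mathcal W_X(0)=\mathcal W_X(1):=\operatorname{Var}(X)$. A positive function $g$ on an interval is log-concave if $\log g$ is concave. *)

theory Defs
  imports "HOL-Probability.Probability"
begin

definition absolutely_continuous_on_interval :: "real \<Rightarrow> real \<Rightarrow> (real \<Rightarrow> real) \<Rightarrow> bool" where
  "absolutely_continuous_on_interval c d f \<longleftrightarrow>
     (\<forall>\<epsilon>>0. \<exists>\<delta>>0. \<forall>(n::nat) x y.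
        (\<forall>i<n. c \<le> x i \<and> x i \<le> y i \<and> y i \<le> d) \<longrightarrow>
        disjoint_family_on (\<lambda>i. {x i<..<y i}) {..<n} \<longrightarrow>
        (\<Sum>i<n. y i - x i) < \<delta> \<longrightarrow>
        (\<Sum>i<n. \<bar>f (y i) - f (x i)\<bar>) < \<epsilon>)"

definition locally_absolutely_continuous_on :: "real set \<Rightarrow> (real \<Rightarrow> real) \<Rightarrow> bool" where
  "locally_absolutely_continuous_on S f \<longleftrightarrow>
     (\<forall>c d. c \<le> d \<longrightarrow> {c..d} \<subseteq> S \<longrightarrow> absolutely_continuous_on_interval c d f)"

definition log_concave_on :: "real set \<Rightarrow> (real \<Rightarrow> real) \<Rightarrow> bool" where
  "log_concave_on S g \<longleftrightarrow> is_interval S \<and> (\<forall>x\<in>S. 0 < g x) \<and> concave_on S (\<lambda>x. ln (g x))"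

definition has_nonincreasing_representative :: "(real \<Rightarrow> real) \<Rightarrow> bool" where
  "has_nonincreasing_representative f \<longleftrightarrow>
     (\<exists>g. antimono_on {0<..<1} g \<and> (AE u\<in>{0<..<1} in lborel. f u = g u))"

definition dist_fun :: "'a measure \<Rightarrow> ('a \<Rightarrow> real) \<Rightarrow> real \<Rightarrow> real" where
  "dist_fun M X = cdf (distr M borel X)"

definition quantile :: "'a measure \<Rightarrow> ('a \<Rightarrow> real) \<Rightarrow> real \<Rightarrow> real" where
  "quantile M X u = Inf {x. u \<le> dist_fun M X x}"

definition lower_mean :: "'a measure \<Rightarrow> ('a \<Rightarrow> real) \<Rightarrow> real \<Rightarrow> real" where
  "lower_mean M X u = 1 / u * (LINT v:{0<..<u}|lborel. quantile M X v)"

definition upper_mean :: "'a measure \<Rightarrow> ('a \<Rightarrow> real) \<Rightarrow> real \<Rightarrow> real" where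
  "upper_mean M X u = 1 / (1 - u) * (LINT v:{u<..<1}|lborel. quantile M X v)"

text \<open>Integrals run over open intervals because \<^term>\<open>quantile\<close> is unspecified at 0 (and possibly
at 1), where the infimum is over an unbounded or empty set. Only the values of the profile on \<open>{0..1}\<close> are
meaningful.\<close>
definition risk_profile :: "'a measure \<Rightarrow> ('a \<Rightarrow> real) \<Rightarrow> real \<Rightarrow> real" where
  "risk_profile M X u =
     (if u = 0 \<or> u = 1 then prob_space.variance M X
      else (LINT v:{0<..<u}|lborel. (quantile M X v - lower_mean M X u)\<^sup>2)
         + (LINT v:{u<..<1}|lborel. (quantile M X v - upper_mean M X u)\<^sup>2))"

definition cond_expectation :: "'a measure \<Rightarrow> ('a \<Rightarrow> real) \<Rightarrow> 'a set \<Rightarrow> real" where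
  "cond_expectation M Y A = (LINT \<omega>:A|M. Y \<omega>) / measure M A"

definition J_set :: "'a measure \<Rightarrow> ('a \<Rightarrow> real) \<Rightarrow> real set" where
  "J_set M X = {t. 0 < dist_fun M X t \<and> dist_fun M X t < 1}"

definition lower_dev :: "'a measure \<Rightarrow> ('a \<Rightarrow> real) \<Rightarrow> real \<Rightarrow> real" where
  "lower_dev M X t = cond_expectation M (\<lambda>\<omega>. t - X \<omega>) {\<omega>\<in>space M. X \<omega> < t}"

definition upper_dev :: "'a measure \<Rightarrow> ('a \<Rightarrow> real) \<Rightarrow> real \<Rightarrow> real" where
  "upper_dev M X t = cond_expectation M (\<lambda>\<omega>. X \<omega> - t) {\<omega>\<in>space M. X \<omega> > t}"

definition dev_diff :: "'a measure \<Rightarrow> ('a \<Rightarrow> real) \<Rightarrow> real \<Rightarrow> real" where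
  "dev_diff M X t = (upper_dev M X t)\<^sup>2 - (lower_dev M X t)\<^sup>2"

definition atomless_law :: "'a measure \<Rightarrow> ('a \<Rightarrow> real) \<Rightarrow> bool" where
  "atomless_law M X \<longleftrightarrow> (\<forall>x. measure (distr M borel X) {x} = 0)"

definition nondegenerate_law :: "'a measure \<Rightarrow> ('a \<Rightarrow> real) \<Rightarrow> bool" where
  "nondegenerate_law M X \<longleftrightarrow> \<not> (\<exists>c. AE \<omega> in M. X \<omega> = c)"

definition is_median :: "'a measure \<Rightarrow> ('a \<Rightarrow> real) \<Rightarrow> real \<Rightarrow> bool" where
  "is_median M X m \<longleftrightarrow>
     \<P>(\<omega> in M. X \<omega> \<le> m) \<ge> 1 / 2 \<and> \<P>(\<omega> in M. X \<omega> \<ge> m) \<ge> 1 / 2"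

definition law_support :: "'a measure \<Rightarrow> ('a \<Rightarrow> real) \<Rightarrow> real set" where
  "law_support M X = {x. \<forall>U. open U \<longrightarrow> x \<in> U \<longrightarrow> 0 < measure (distr M borel X) U}"

end

theory Submission
  imports Defs
begin

text \<open>Write \<open>L u\<close> and \<open>S u\<close> for the integrals of the quantile function \<open>Q\<close> and of its square over
\<open>(0,u)\<close>. Expanding the squares gives \<open>W u = S 1 - (L u)\<^sup>2 / u - (L 1 - L u)\<^sup>2 / (1 - u)\<close>, which is
continuous on \<open>[0,1]\<close> by the Cauchy-Schwarz inequality. As \<open>Q\<close> is left continuous, \<open>L\<close> has left
derivative \<open>Q\<close> everywhere on \<open>(0,1)\<close>, so \<open>W\<close> has a left derivative everywhere, and it equals
\<open>- D \<circ> Q\<close>; at the continuity points of \<open>Q\<close> it is a derivative. Having a one-sided derivative at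
every point replaces the fundamental theorem of calculus: increments of \<open>W\<close> are bounded by bounds on its
left derivative, which yields absolute continuity, the convexity criterion and the minimality of \<open>1/2\<close>.
For log-concave laws, the conditional deviations are averages of \<open>t - Q (F t * p)\<close> and
\<open>Q (1 - (1 - F t) * p) - t\<close> over \<open>p\<close> in \<open>(0,1)\<close>, and these are monotone in \<open>t\<close> for each fixed \<open>p\<close>.\<close>

section \<open>Real functions\<close>

text \<open>If \<open>f a < f b\<close>, pick the level \<open>c\<close> halfway between. At the
  first point \<open>x\<close> where \<open>f\<close> reaches that level, all earlier values are
  smaller, so the difference quotients from the left are nonnegative and the left derivative at
  \<open>x\<close> cannot be negative.\<close>

lemma left_derivative_neg_imp_le:
  fixes f :: "real \<Rightarrow> real"
  assumes "a \<le> b" and cont: "continuous_on {a..b} f"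
    and der: "\<And>x. a < x \<Longrightarrow> x < b \<Longrightarrow> \<exists>D<0. (f has_real_derivative D) (at_left x)"
  shows "f b \<le> f a"
proof (rule ccontr)
  assume "\<not> f b \<le> f a"
  define c where "c = (f a + f b) / 2"
  have c: "f a < c" "c < f b" using \<open>\<not> f b \<le> f a\<close> by (auto simp: c_def field_simps)
  define A where "A = {t \<in> {a..b}. c \<le> f t}"
  have "A = {a..b} \<inter> f -` {c..}" by (auto simp: A_def)
  then have "closed A"
    by (simp add: continuous_closed_preimage[OF cont])
  moreover have "A \<subseteq> {a..b}" by (auto simp: A_def)
  ultimately have "compact A"
    using closed_Int_compact[of A "{a..b}"] by (simp add: Int_absorb2)
  moreover have "b \<in> A" using c \<open>a \<le> b\<close> by (auto simp: A_def)
  ultimately obtain x where x: "x \<in> A" "\<And>t. t \<in> A \<Longrightarrow> x \<le> t"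
    using compact_attains_inf[of A] by auto
  \<comment> \<open>The derivative is only given inside the interval, so \<open>x < b\<close> is
    required: the level \<open>c\<close> is attained before \<open>b\<close>, because
    \<open>c < f b\<close>.\<close>
  obtain t where "a \<le> t" "t \<le> b" "f t = c"
    using IVT'[of f a c b] c cont \<open>a \<le> b\<close> by auto
  then have "t \<in> A" "t \<noteq> b" using c by (auto simp: A_def)
  with x have "x < b" using \<open>t \<le> b\<close> by force
  moreover have "a < x" using x(1) c by (cases "x = a") (auto simp: A_def)
  ultimately obtain D where D: "D < 0" "(f has_real_derivative D) (at_left x)"
    using der by blast
  have "eventually (\<lambda>y. 0 \<le> (f y - f x) / (y - x)) (at_left x)"
    unfolding eventually_at_left_field
  proof (intro exI[of _ a] conjI allI impI \<open>a < x\<close>)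
    fix y assume y: "a < y" "y < x"
    then have "y \<notin> A" using x by force
    then have "f y < f x" using y x(1) by (auto simp: A_def)
    then show "0 \<le> (f y - f x) / (y - x)" using y by (simp add: divide_nonpos_neg)
  qed
  then have "0 \<le> D"
    using D(2) by (intro tendsto_lowerbound[of _ D "at_left x"]) (auto simp: has_field_derivative_iff)
  with D show False by simp
qed

text \<open>Subtracting a linear function of slope \<open>B + e\<close> makes the left derivative at
  most \<open>- e\<close>, so the previous lemma applies; then \<open>e\<close> tends to 0.\<close>

lemma left_derivative_le_imp_increment_le:
  fixes f :: "real \<Rightarrow> real"
  assumes "a \<le> b" and cont: "continuous_on {a..b} f"
    and der: "\<And>x. a < x \<Longrightarrow> x < b \<Longrightarrow> (f has_real_derivative f' x) (at_left x)"
    and le: "\<And>x. a < x \<Longrightarrow> x < b \<Longrightarrow> f' x \<le> B"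
  shows "f b - f a \<le> B * (b - a)"
proof -
  have *: "f b - f a \<le> (B + e) * (b - a)" if "e > 0" for e
  proof -
    have "f b - (B + e) * b \<le> f a - (B + e) * a"
    proof (rule left_derivative_neg_imp_le[where f = "\<lambda>x. f x - (B + e) * x"])
      show "continuous_on {a..b} (\<lambda>x. f x - (B + e) * x)"
        by (intro continuous_intros cont)
      fix x assume x: "a < x" "x < b"
      show "\<exists>D<0. ((\<lambda>x. f x - (B + e) * x) has_real_derivative D) (at_left x)"
        by (rule exI[of _ "f' x - (B + e)"])
          (use le[OF x] \<open>e > 0\<close> in \<open>auto intro!: derivative_eq_intros der[OF x]\<close>)
    qed fact
    then show ?thesis by (simp add: algebra_simps)
  qed
  have "((\<lambda>e. (B + e) * (b - a)) \<longlongrightarrow> (B + 0) * (b - a)) (at_right 0)"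
    by (intro tendsto_intros)
  then have "f b - f a \<le> (B + 0) * (b - a)"
    by (rule tendsto_lowerbound) (auto intro: eventually_mono[OF eventually_at_right_less] *)
  then show ?thesis by simp
qed

lemma left_derivative_ge_imp_increment_ge:
  fixes f :: "real \<Rightarrow> real"
  assumes "a \<le> b" and cont: "continuous_on {a..b} f"
    and der: "\<And>x. a < x \<Longrightarrow> x < b \<Longrightarrow> (f has_real_derivative f' x) (at_left x)"
    and ge: "\<And>x. a < x \<Longrightarrow> x < b \<Longrightarrow> B \<le> f' x"
  shows "B * (b - a) \<le> f b - f a"
proof -
  have "(- f b) - (- f a) \<le> - B * (b - a)"
    by (rule left_derivative_le_imp_increment_le[where f = "\<lambda>x. - f x" and f' = "\<lambda>x. - f' x"])
      (use assms in \<open>auto intro: continuous_on_minus DERIV_minus\<close>)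
  then show ?thesis by simp
qed

lemma absolutely_continuous_on_interval_left_derivative_bounded:
  fixes f :: "real \<Rightarrow> real"
  assumes cont: "continuous_on {c..d} f"
    and der: "\<And>x. c < x \<Longrightarrow> x < d \<Longrightarrow> (f has_real_derivative f' x) (at_left x)"
    and bd: "\<And>x. c < x \<Longrightarrow> x < d \<Longrightarrow> \<bar>f' x\<bar> \<le> B"
  shows "absolutely_continuous_on_interval c d f"
  unfolding absolutely_continuous_on_interval_def
proof (intro allI impI)
  \<comment> \<open>A Lipschitz constant for \<open>f\<close>; the lower bound 1 makes
    \<open>e / K\<close> a legitimate positive choice of delta.\<close>
  define K where "K = max B 1"
  have lip: "\<bar>f y - f x\<bar> \<le> K * (y - x)" if "c \<le> x" "x \<le> y" "y \<le> d" for x y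
  proof -
    have "\<bar>f' z\<bar> \<le> K" if "x < z" "z < y" for z
      using bd[of z] \<open>c \<le> x\<close> \<open>y \<le> d\<close> that by (auto simp: K_def)
    then have K: "f' z \<le> K" "- K \<le> f' z" if "x < z" "z < y" for z
      using that by (auto simp: abs_le_iff minus_le_iff)
    have "continuous_on {x..y} f" using cont by (rule continuous_on_subset) (use that in auto)
    moreover have "(f has_real_derivative f' z) (at_left z)" if "x < z" "z < y" for z
      using \<open>c \<le> x\<close> \<open>y \<le> d\<close> that by (intro der) auto
    ultimately show ?thesis
      using left_derivative_le_imp_increment_le[of x y f f' K]
        left_derivative_ge_imp_increment_ge[of x y f f' "- K"] K that by fastforce
  qed
  fix e :: real assume "e > 0"
  show "\<exists>\<delta>>0. \<forall>n x y. (\<forall>i<n. c \<le> x i \<and> x i \<le> y i \<and> y i \<le> d) \<longrightarrow>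
      disjoint_family_on (\<lambda>i. {x i<..<y i}) {..<n} \<longrightarrow>
      (\<Sum>i<n. y i - x i) < \<delta> \<longrightarrow> (\<Sum>i<n. \<bar>f (y i) - f (x i)\<bar>) < e"
  proof (intro exI[of _ "e / K"] conjI allI impI)
    show "0 < e / K" using \<open>e > 0\<close> by (auto simp: K_def)
    fix n x y
    assume *: "\<forall>i<n. c \<le> x i \<and> x i \<le> y i \<and> y i \<le> d" and **: "(\<Sum>i<n. y i - x i) < e / K"
    have "(\<Sum>i<n. \<bar>f (y i) - f (x i)\<bar>) \<le> (\<Sum>i<n. K * (y i - x i))"
      by (intro sum_mono lip) (use * in auto)
    also have "\<dots> = K * (\<Sum>i<n. y i - x i)" by (simp add: sum_distrib_left)
    also have "\<dots> < e" using ** by (simp add: K_def field_simps)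
    finally show "(\<Sum>i<n. \<bar>f (y i) - f (x i)\<bar>) < e" .
  qed
qed

section \<open>Convexity and monotone left derivatives\<close>

lemma convex_on_imp_mono_left_derivative:
  fixes f :: "real \<Rightarrow> real"
  assumes conv: "convex_on {a..b} f"
    and der: "\<And>x. a < x \<Longrightarrow> x < b \<Longrightarrow> (f has_real_derivative f' x) (at_left x)"
  shows "mono_on {a<..<b} f'"
proof (rule mono_onI)
  fix x y assume xy: "x \<in> {a<..<b}" "y \<in> {a<..<b}" "x \<le> y"
  show "f' x \<le> f' y"
  proof (cases "x = y")
    case False
    with xy have less: "x < y" by simp
    \<comment> \<open>The secant slope separates the two derivatives: by convexity, difference
      quotients taken from the left at \<open>x\<close> are at most \<open>s\<close>, and those at
      \<open>y\<close> are at least \<open>s\<close>.\<close>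
    define s where "s = (f y - f x) / (y - x)"
    have "f' x \<le> s"
    proof (rule tendsto_upperbound)
      show "((\<lambda>t. (f t - f x) / (t - x)) \<longlongrightarrow> f' x) (at_left x)"
        using der[of x] xy by (auto simp: has_field_derivative_iff)
      show "\<forall>\<^sub>F t in at_left x. (f t - f x) / (t - x) \<le> s"
        unfolding eventually_at_left_field
      proof (intro exI[of _ a] conjI allI impI)
        fix t assume t: "a < t" "t < x"
        have "(f t - f y) / (t - y) \<le> (f x - f y) / (x - y)"
          "(f t - f x) / (t - x) \<le> (f t - f y) / (t - y)"
          using convex_on_slope_le[OF conv, of t y x] t xy less by auto
        moreover have "(f x - f y) / (x - y) = s" by (simp add: s_def divide_simps) argo
        ultimately show "(f t - f x) / (t - x) \<le> s" by linarith
      qed (use xy in auto)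
    qed simp
    moreover have "s \<le> f' y"
    proof (rule tendsto_lowerbound)
      show "((\<lambda>t. (f t - f y) / (t - y)) \<longlongrightarrow> f' y) (at_left y)"
        using der[of y] xy by (auto simp: has_field_derivative_iff)
      show "\<forall>\<^sub>F t in at_left y. s \<le> (f t - f y) / (t - y)"
        unfolding eventually_at_left_field
      proof (intro exI[of _ x] conjI allI impI less)
        fix t assume t: "x < t" "t < y"
        have "(f x - f y) / (x - y) \<le> (f t - f y) / (t - y)"
          using convex_on_slope_le[OF conv, of x y t] t xy less by auto
        moreover have "(f x - f y) / (x - y) = s" by (simp add: s_def divide_simps) argo
        ultimately show "s \<le> (f t - f y) / (t - y)" by linarith
      qed
    qed simp
    ultimately show ?thesis by simp
  qed simp
qed

text \<open>The left derivative is at least \<open>f' v\<close> to the right of \<open>v\<close> and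
  at most \<open>f' v\<close> to the left, so the increment bounds put \<open>f\<close> above its
  supporting line at \<open>v\<close>. Continuity extends this to the endpoints.\<close>

lemma mono_left_derivative_subgradient:
  fixes f :: "real \<Rightarrow> real"
  assumes cont: "continuous_on {a..b} f"
    and der: "\<And>x. a < x \<Longrightarrow> x < b \<Longrightarrow> (f has_real_derivative f' x) (at_left x)"
    and mono: "mono_on {a<..<b} f'"
    and v: "v \<in> {a<..<b}" and y: "y \<in> {a..b}"
  shows "f v + f' v * (y - v) \<le> f y"
proof (cases "v \<le> y")
  case True
  have "f' v * (y - v) \<le> f y - f v"
    by (rule left_derivative_ge_imp_increment_ge[where f' = f'])
      (use True v y in \<open>auto intro!: der mono_onD[OF mono] continuous_on_subset[OF cont]\<close>)
  then show ?thesis by simp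
next
  case False
  have "f v - f y \<le> f' v * (v - y)"
    by (rule left_derivative_le_imp_increment_le[where f' = f'])
      (use False v y in \<open>auto intro!: der mono_onD[OF mono] continuous_on_subset[OF cont]\<close>)
  then show ?thesis by (simp add: algebra_simps)
qed

lemma convex_on_iff_mono_left_derivative:
  fixes f :: "real \<Rightarrow> real"
  assumes cont: "continuous_on {a..b} f"
    and der: "\<And>x. a < x \<Longrightarrow> x < b \<Longrightarrow> (f has_real_derivative f' x) (at_left x)"
  shows "convex_on {a..b} f \<longleftrightarrow> mono_on {a<..<b} f'"
proof
  assume mono: "mono_on {a<..<b} f'"
  show "convex_on {a..b} f"
  proof (rule convex_on_linorderI)
    fix t x y :: real
    assume t: "0 < t" "t < 1" and x: "x \<in> {a..b}" and y: "y \<in> {a..b}" and less: "x < y"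
    define z where "z = (1 - t) * x + t * y"
    have z: "z - x = t * (y - x)" "y - z = (1 - t) * (y - x)"
      by (simp_all add: z_def algebra_simps)
    have "0 < z - x" "0 < y - z" unfolding z using t less by auto
    then have "z \<in> {a<..<b}" using x y by auto
    then have sub: "f z + f' z * (w - z) \<le> f w" if "w \<in> {a..b}" for w
      using mono_left_derivative_subgradient[OF cont der mono _ that] by blast
    \<comment> \<open>Averaging the supporting line at \<open>z\<close> over \<open>x\<close> and
      \<open>y\<close> cancels the linear terms, since \<open>z\<close> is their barycentre.\<close>
    have "(1 - t) * (f z + f' z * (x - z)) + t * (f z + f' z * (y - z)) \<le> (1 - t) * f x + t * f y"
      using sub[OF x] sub[OF y] t by (intro add_mono mult_left_mono) auto
    moreover have "(1 - t) * (f z + f' z * (x - z)) + t * (f z + f' z * (y - z)) = f z"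
      by (simp add: z_def algebra_simps)
    ultimately show "f ((1 - t) *\<^sub>R x + t *\<^sub>R y) \<le> (1 - t) * f x + t * f y"
      by (simp add: z_def)
  qed simp
qed (rule convex_on_imp_mono_left_derivative[OF _ der])

section \<open>Monotone representatives of left continuous functions\<close>

lemma AE_lborel_obtain_in_interval:
  fixes p q :: real
  assumes "AE x in lborel. P x" "p < q"
  obtains x where "p < x" "x < q" "P x"
proof -
  have "\<exists>x. p < x \<and> x < q \<and> P x"
  proof (rule ccontr)
    assume "\<not> ?thesis"
    then have "AE x in lborel. x \<notin> {p<..<q}"
      using assms(1) by (auto elim!: eventually_mono)
    then have "{p<..<q} \<in> null_sets lborel"
      by (subst (asm) AE_iff_null_sets[symmetric]) auto
    then have "emeasure lborel {p<..<q} = 0" by auto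
    then show False using \<open>p < q\<close> by simp
  qed
  then show ?thesis using that by blast
qed

text \<open>If \<open>f u < f v\<close> for some \<open>u < v\<close>, left continuity keeps
  \<open>f\<close> on opposite sides of a level \<open>c\<close> just to the left of
  \<open>u\<close> and of \<open>v\<close>. Both one-sided neighbourhoods contain points where
  \<open>f\<close> equals its monotone representative, which is contradictory. Conversely
  \<open>f\<close> represents itself.\<close>

lemma has_nonincreasing_representative_iff:
  assumes cont: "\<And>u. u \<in> {0<..<1} \<Longrightarrow> continuous (at_left u) f"
  shows "has_nonincreasing_representative f \<longleftrightarrow> antimono_on {0<..<1} f"
proof
  assume "has_nonincreasing_representative f"
  then obtain g where g: "antimono_on {0<..<1} g" and ae: "AE u\<in>{0<..<1} in lborel. f u = g u"
    unfolding has_nonincreasing_representative_def by blast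
  show "antimono_on {0<..<1} f"
  proof (rule monotone_onI)
    fix u v :: real assume uv: "u \<in> {0<..<1}" "v \<in> {0<..<1}" "u \<le> v"
    show "f u \<ge> f v"
    proof (cases "u = v")
      case False
      with uv have "u < v" by simp
      show ?thesis
      proof (rule ccontr)
        assume "\<not> f u \<ge> f v"
        define c where "c = (f u + f v) / 2"
        have c: "f u < c" "c < f v" using \<open>\<not> f u \<ge> f v\<close> by (auto simp: c_def field_simps)
        have "\<forall>\<^sub>F x in at_left u. f x < c" "\<forall>\<^sub>F x in at_left v. c < f x"
          using cont[OF uv(1)] cont[OF uv(2)] c by (auto simp: continuous_within intro: order_tendstoD)
        then obtain p q where p: "p < u" "\<And>x. p < x \<Longrightarrow> x < u \<Longrightarrow> f x < c"
          and q: "q < v" "\<And>x. q < x \<Longrightarrow> x < v \<Longrightarrow> c < f x"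
          unfolding eventually_at_left_field by blast
        \<comment> \<open>The bound \<open>max p 0\<close> keeps \<open>x\<close> in the unit
          interval, and \<open>max q u\<close> below ensures \<open>x < u < y\<close>.\<close>
        obtain x where x: "max p 0 < x" "x < u" "x \<in> {0<..<1} \<longrightarrow> f x = g x"
          using AE_lborel_obtain_in_interval[OF ae, of "max p 0" u] p uv by auto
        obtain y where y: "max q u < y" "y < v" "y \<in> {0<..<1} \<longrightarrow> f y = g y"
          using AE_lborel_obtain_in_interval[OF ae, of "max q u" v] q uv \<open>u < v\<close> by auto
        have "f x < c" "c < f y" using p(2)[of x] q(2)[of y] x y by auto
        moreover have "g y \<le> g x"
          using monotone_onD[OF g, of x y] x y uv by auto
        ultimately show False using x y uv by auto
      qed
    qed simp
  qed
qed (auto simp: has_nonincreasing_representative_def)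

text \<open>The inner points \<open>x + h\<close> and \<open>y\<close> are convex combinations of
  the outer points \<open>x\<close> and \<open>y + h\<close> with swapped weights. Adding the two
  concavity inequalities for the logarithm gives the product inequality.\<close>

lemma log_concave_on_mult_le:
  fixes g :: "real \<Rightarrow> real"
  assumes g: "log_concave_on S g" and mem: "x \<in> S" "y + h \<in> S" and le: "x \<le> y" "0 \<le> h"
  shows "g x * g (y + h) \<le> g (x + h) * g y"
proof (cases "x = y + h")
  case True
  then have "x = y" "h = 0" using le by auto
  then show ?thesis by simp
next
  case False
  with le have pos: "0 < y + h - x" by simp
  define k where "k = h / (y + h - x)"
  have k: "0 \<le> k" "k \<le> 1" and k_eq: "k * (y + h - x) = h"
    using pos le by (auto simp: k_def field_simps)
  have eq: "x + h = (1 - k) *\<^sub>R x + k *\<^sub>R (y + h)" "y = (1 - (1 - k)) *\<^sub>R x + (1 - k) *\<^sub>R (y + h)"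
    using k_eq by (auto simp: algebra_simps)
  have conc: "concave_on S (\<lambda>x. ln (g x))" using g by (simp add: log_concave_on_def)
  have "x + h \<in> S" "y \<in> S"
    using g mem le mem_is_interval_1_I[of S x "y + h"] by (auto simp: log_concave_on_def)
  then have p: "0 < g x" "0 < g (y + h)" "0 < g (x + h)" "0 < g y"
    using g mem by (auto simp: log_concave_on_def)
  have "(1 - k) * ln (g x) + k * ln (g (y + h)) \<le> ln (g (x + h))"
    unfolding eq(1) using concave_onD[OF conc, of k x "y + h"] k mem by simp
  moreover have "(1 - (1 - k)) * ln (g x) + (1 - k) * ln (g (y + h)) \<le> ln (g y)"
    using concave_onD[OF conc, of "1 - k" x "y + h"] k mem unfolding eq(2)[symmetric] by simp
  ultimately have "ln (g x) + ln (g (y + h)) \<le> ln (g (x + h)) + ln (g y)"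
    by (simp add: algebra_simps)
  then have "ln (g x * g (y + h)) \<le> ln (g (x + h) * g y)"
    using p by (simp add: ln_mult)
  then show ?thesis using p by (simp add: mult_pos_pos)
qed

section \<open>The quantile function\<close>

lemma set_integral_eq_integral_Icc:
  fixes f :: "real \<Rightarrow> real"
  assumes "set_integrable lborel {0<..<1} f" "0 \<le> u" "v \<le> 1"
  shows "f integrable_on {u..v}" and "(LINT x:{u<..<v}|lborel. f x) = integral {u..v} f"
proof -
  have "set_integrable lborel {u<..<v} f"
    using assms by (auto intro: set_integrable_subset)
  from set_borel_integral_eq_integral[OF this]
  show "f integrable_on {u..v}" and "(LINT x:{u<..<v}|lborel. f x) = integral {u..v} f"
    by (simp_all add: integrable_on_Icc_iff_Ioo integral_open_interval_real)
qed

lemma set_integral_shift_le: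
  fixes f g :: "real \<Rightarrow> real"
  assumes "set_integrable lborel {0<..<1} f" "set_integrable lborel {0<..<1} g"
    and "\<And>p. p \<in> {0<..<1} \<Longrightarrow> f p \<le> g p + c"
  shows "(LINT p:{0<..<1}|lborel. f p) \<le> (LINT p:{0<..<1}|lborel. g p) + c"
proof -
  have c: "set_integrable lborel {0<..<1::real} (\<lambda>p. c)"
    unfolding set_integrable_def by (intro integrable_scaleR_left integrable_real_indicator) auto
  have "(LINT p:{0<..<1}|lborel. f p) \<le> (LINT p:{0<..<1}|lborel. g p + c)"
    using assms c by (intro set_integral_mono set_integral_add) auto
  also have "\<dots> = (LINT p:{0<..<1}|lborel. g p) + c"
    using assms c by (simp add: set_integral_const)
  finally show ?thesis .
qed

locale atomless_square_integrable = prob_space M for M :: "'a measure" +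
  fixes X :: "'a \<Rightarrow> real"
  assumes X_measurable [measurable]: "X \<in> borel_measurable M"
    and X_square_integrable: "integrable M (\<lambda>\<omega>. (X \<omega>)\<^sup>2)"
    and X_atomless: "atomless_law M X"
begin

abbreviation "Q \<equiv> quantile M X"
abbreviation "F \<equiv> dist_fun M X"
abbreviation "W \<equiv> risk_profile M X"
abbreviation "J \<equiv> J_set M X"

sublocale law: cdf_distribution "distr M borel X"
  by (simp add: cdf_distribution_def)

text \<open>This identification gives access to the pseudo-inverse \<open>law.I\<close>: its Galois
  connection with the distribution function, and the fact that it pushes Lebesgue measure on the
  unit interval to the law of \<open>X\<close>.\<close>

lemma quantile_eq_pseudoinverse: "Q = law.I"
  by (simp add: fun_eq_iff quantile_def dist_fun_def)

lemma F_mono: "x \<le> y \<Longrightarrow> F x \<le> F y"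
  by (simp add: dist_fun_def law.cdf_nondecreasing)

lemma F_bounds: "0 \<le> F x" "F x \<le> 1"
  by (simp_all add: dist_fun_def law.cdf_nonneg law.cdf_bounded_prob)

lemma isCont_F: "isCont F x"
  using X_atomless by (simp add: dist_fun_def law.isCont_cdf atomless_law_def)

lemma quantile_le_iff: "u \<in> {0<..<1} \<Longrightarrow> Q u \<le> x \<longleftrightarrow> u \<le> F x"
  using law.pseudoinverse[of u x] by (simp add: quantile_eq_pseudoinverse dist_fun_def)

text \<open>\<open>F\<close> stays at most \<open>u\<close> to the left of \<open>Q u\<close>, and
  without atoms \<open>F\<close> is continuous, so the bound passes to the limit; the other
  inequality is the Galois connection. In particular \<open>Q\<close> is strictly
  increasing.\<close>

lemma F_quantile: assumes u: "u \<in> {0<..<1}" shows "F (Q u) = u"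
proof (rule antisym)
  have "(F \<longlongrightarrow> F (Q u)) (at_left (Q u))"
    using isCont_F[of "Q u"] by (simp add: isCont_def filterlim_at_split)
  then show "F (Q u) \<le> u"
  proof (rule tendsto_upperbound)
    have "F y \<le> u" if "y < Q u" for y
      using quantile_le_iff[OF u, of y] that by linarith
    then show "\<forall>\<^sub>F y in at_left (Q u). F y \<le> u"
      unfolding eventually_at_left_field by (intro exI[of _ "Q u - 1"]) auto
  qed simp
qed (use quantile_le_iff[OF u, of "Q u"] in simp)

lemma quantile_mem_J: "u \<in> {0<..<1} \<Longrightarrow> Q u \<in> J"
  by (simp add: J_set_def F_quantile)

lemma F_mem_unit: "t \<in> J \<Longrightarrow> F t \<in> {0<..<1}"
  by (simp add: J_set_def)

lemma quantile_less_iff: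
  assumes "u \<in> {0<..<1}" "v \<in> {0<..<1}"
  shows "Q u < Q v \<longleftrightarrow> u < v"
  using quantile_le_iff[OF assms(2), of "Q u"] F_quantile[OF assms(1)] by linarith

lemma quantile_mono: "u \<in> {0<..<1} \<Longrightarrow> v \<in> {0<..<1} \<Longrightarrow> u \<le> v \<Longrightarrow> Q u \<le> Q v"
  using quantile_less_iff[of v u] by linarith

lemma quantile_left_continuous: assumes u: "u \<in> {0<..<1}" shows "continuous (at_left u) Q"
  unfolding continuous_within
proof (rule order_tendstoI)
  fix c assume "c < Q u"
  then have c: "F c < u" using quantile_le_iff[OF u, of c] by linarith
  show "\<forall>\<^sub>F v in at_left u. c < Q v"
    unfolding eventually_at_left_field
  proof (intro exI[of _ "F c"] conjI allI impI c)
    fix v assume v: "F c < v" "v < u"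
    then have "v \<in> {0<..<1}" using u F_bounds[of c] by auto
    then show "c < Q v" using quantile_le_iff[of v c] v by linarith
  qed
next
  fix c assume c: "Q u < c"
  show "\<forall>\<^sub>F v in at_left u. Q v < c"
    unfolding eventually_at_left_field
  proof (intro exI[of _ 0] conjI allI impI)
    fix v :: real assume v: "0 < v" "v < u"
    then show "Q v < c" using quantile_mono[of v u] u c by auto
  qed (use u in auto)
qed

lemma quantile_borel_measurable: "Q \<in> borel_measurable (restrict_space lborel {0<..<1})"
  using law.measurable_CI unfolding quantile_eq_pseudoinverse
  by (simp add: measurable_def space_restrict_space sets_restrict_space)

text \<open>Both sides are integrals against the same law, written once as the image of
  \<open>M\<close> under \<open>X\<close> and once as the image of Lebesgue measure on the unit
  interval under \<open>Q\<close>.\<close>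

lemma
  fixes h :: "real \<Rightarrow> real"
  assumes [measurable]: "h \<in> borel_measurable borel"
  shows integrable_iff_quantile:
      "integrable M (\<lambda>\<omega>. h (X \<omega>)) \<longleftrightarrow> set_integrable lborel {0<..<1} (\<lambda>v. h (Q v))"
    and integral_eq_quantile:
      "(\<integral>\<omega>. h (X \<omega>) \<partial>M) = (LINT v:{0<..<1}|lborel. h (Q v))"
proof -
  have *: "distr M borel X = distr (restrict_space lborel {0<..<1}) borel Q"
    using law.distr_I_eq_M by (simp add: quantile_eq_pseudoinverse)
  have "integrable M (\<lambda>\<omega>. h (X \<omega>)) \<longleftrightarrow> integrable (distr M borel X) h"
    by (simp add: integrable_distr_eq)
  also have "\<dots> \<longleftrightarrow> integrable (restrict_space lborel {0<..<1}) (\<lambda>v. h (Q v))"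
    unfolding * by (rule integrable_distr_eq[OF quantile_borel_measurable]) simp
  also have "\<dots> \<longleftrightarrow> set_integrable lborel {0<..<1} (\<lambda>v. h (Q v))"
    by (simp add: integrable_restrict_space set_integrable_def)
  finally show "integrable M (\<lambda>\<omega>. h (X \<omega>)) \<longleftrightarrow> set_integrable lborel {0<..<1} (\<lambda>v. h (Q v))" .
  have "(\<integral>\<omega>. h (X \<omega>) \<partial>M) = integral\<^sup>L (distr M borel X) h"
    by (simp add: integral_distr)
  also have "\<dots> = integral\<^sup>L (restrict_space lborel {0<..<1}) (\<lambda>v. h (Q v))"
    unfolding * by (rule integral_distr[OF quantile_borel_measurable]) simp
  also have "\<dots> = (LINT v:{0<..<1}|lborel. h (Q v))"
    by (simp add: integral_restrict_space set_lebesgue_integral_def)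
  finally show "(\<integral>\<omega>. h (X \<omega>) \<partial>M) = (LINT v:{0<..<1}|lborel. h (Q v))" .
qed

lemma X_integrable: "integrable M X"
  using X_square_integrable by (rule square_integrable_imp_integrable[rotated]) simp

lemma quantile_integrable: "set_integrable lborel {0<..<1} Q"
  using integrable_iff_quantile[of "\<lambda>x. x"] X_integrable by simp

lemma quantile_square_integrable: "set_integrable lborel {0<..<1} (\<lambda>v. (Q v)\<^sup>2)"
  using integrable_iff_quantile[of "\<lambda>x. x\<^sup>2"] X_square_integrable by simp

lemma quantile_integrable_on: "0 \<le> u \<Longrightarrow> v \<le> 1 \<Longrightarrow> Q integrable_on {u..v}"
  by (rule set_integral_eq_integral_Icc[OF quantile_integrable])

lemma quantile_square_integrable_on: "0 \<le> u \<Longrightarrow> v \<le> 1 \<Longrightarrow> (\<lambda>v. (Q v)\<^sup>2) integrable_on {u..v}"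
  by (rule set_integral_eq_integral_Icc[OF quantile_square_integrable])

section \<open>Integrals of the quantile function and of its square\<close>

definition L :: "real \<Rightarrow> real" where "L u = integral {0..u} Q"
definition S :: "real \<Rightarrow> real" where "S u = integral {0..u} (\<lambda>v. (Q v)\<^sup>2)"

lemma L_S_0 [simp]: "L 0 = 0" "S 0 = 0"
  by (simp_all add: L_def S_def)

lemma continuous_on_L: "continuous_on {0..1} L"
  unfolding L_def by (intro indefinite_integral_continuous_1 quantile_integrable_on) auto

lemma continuous_on_S: "continuous_on {0..1} S"
  unfolding S_def by (intro indefinite_integral_continuous_1 quantile_square_integrable_on) auto

lemma
  assumes "0 \<le> u" "u \<le> v" "v \<le> 1"
  shows integral_quantile: "integral {u..v} Q = L v - L u"
    and integral_quantile_square: "integral {u..v} (\<lambda>v. (Q v)\<^sup>2) = S v - S u"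
  using Henstock_Kurzweil_Integration.integral_combine[where a=0 and c=u and b=v and f=Q] Henstock_Kurzweil_Integration.integral_combine[where a=0 and c=u and b=v and f="\<lambda>v. (Q v)\<^sup>2"] assms
  by (auto simp: L_def S_def quantile_integrable_on quantile_square_integrable_on)

lemma
  shows expectation_eq: "expectation X = L 1"
    and expectation_square_eq: "expectation (\<lambda>\<omega>. (X \<omega>)\<^sup>2) = S 1"
  using integral_eq_quantile[of "\<lambda>x. x"] integral_eq_quantile[of "\<lambda>x. x\<^sup>2"]
    set_integral_eq_integral_Icc[OF quantile_integrable, of 0 1]
    set_integral_eq_integral_Icc[OF quantile_square_integrable, of 0 1]
  by (simp_all add: L_def S_def)

lemma lower_mean_eq: "u \<in> {0<..<1} \<Longrightarrow> lower_mean M X u = L u / u"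
  using set_integral_eq_integral_Icc[OF quantile_integrable, of 0 u] by (simp add: lower_mean_def L_def)

lemma upper_mean_eq: "u \<in> {0<..<1} \<Longrightarrow> upper_mean M X u = (L 1 - L u) / (1 - u)"
  using set_integral_eq_integral_Icc[OF quantile_integrable, of u 1] integral_quantile[of u 1]
  by (simp add: upper_mean_def)

text \<open>The centre \<open>c\<close> stays free: the risk profile uses it with the lower and
  upper means, the Cauchy-Schwarz bound with the mean over the given interval.\<close>

lemma squared_deviation_eq:
  assumes "0 \<le> u" "u \<le> v" "v \<le> 1"
  shows "(LINT x:{u<..<v}|lborel. (Q x - c)\<^sup>2) = S v - S u - 2 * c * (L v - L u) + c\<^sup>2 * (v - u)"
proof -
  have sub: "set_integrable lborel {u<..<v} f" if "set_integrable lborel {0<..<1} f" for f :: "real \<Rightarrow> real"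
    using that by (rule set_integrable_subset) (use assms in auto)
  have c: "set_integrable lborel {u<..<v} (\<lambda>x. c\<^sup>2)"
    unfolding set_integrable_def using assms by (intro integrable_scaleR_left integrable_real_indicator) auto
  have "(LINT x:{u<..<v}|lborel. (Q x - c)\<^sup>2)
      = (LINT x:{u<..<v}|lborel. (Q x)\<^sup>2 - 2 * c * Q x + c\<^sup>2)"
    by (simp add: power2_diff algebra_simps)
  also have "\<dots> = (LINT x:{u<..<v}|lborel. (Q x)\<^sup>2) - 2 * c * (LINT x:{u<..<v}|lborel. Q x) + c\<^sup>2 * (v - u)"
    using sub[OF quantile_integrable] sub[OF quantile_square_integrable] c assms
    by (simp add: set_integral_const)
  finally show ?thesis
    using assms by (simp add: set_integral_eq_integral_Icc quantile_integrable
        quantile_square_integrable integral_quantile integral_quantile_square)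
qed

text \<open>Away from the endpoints this expands the squares around the two means. The formula also
  covers 0 and 1: there one quotient is zero divided by zero, hence zero, and what remains is the
  variance.\<close>

lemma risk_profile_eq:
  assumes "u \<in> {0..1}"
  shows "W u = S 1 - (L u)\<^sup>2 / u - (L 1 - L u)\<^sup>2 / (1 - u)"
proof (cases "u = 0 \<or> u = 1")
  case True
  have "variance X = S 1 - (L 1)\<^sup>2"
    using variance_eq[OF X_integrable X_square_integrable]
    by (simp add: expectation_eq expectation_square_eq)
  then show ?thesis using True by (auto simp: risk_profile_def)
next
  case False
  with assms have u: "u \<in> {0<..<1}" by auto
  have eq: "s - 2 * (l / w) * l + (l / w)\<^sup>2 * w = s - l\<^sup>2 / w" if "w \<noteq> 0" for s l w :: real
    using that by (simp add: field_simps power2_eq_square)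
  show ?thesis
    using u False eq[of u "S u" "L u"] eq[of "1 - u" "S 1 - S u" "L 1 - L u"]
    by (simp add: risk_profile_def lower_mean_eq upper_mean_eq squared_deviation_eq)
qed

text \<open>The Cauchy-Schwarz inequality, read as nonnegativity of the squared deviation of
  \<open>Q\<close> from its mean over an interval.\<close>

lemma
  assumes u: "u \<in> {0..1}"
  shows L_square_le: "(L u)\<^sup>2 / u \<le> S u"
    and L_complement_square_le: "(L 1 - L u)\<^sup>2 / (1 - u) \<le> S 1 - S u"
proof -
  have *: "(L v - L u)\<^sup>2 / (v - u) \<le> S v - S u" if "0 \<le> u" "u < v" "v \<le> 1" for u v
  proof -
    define c where "c = (L v - L u) / (v - u)"
    have "0 \<le> (LINT x:{u<..<v}|lborel. (Q x - c)\<^sup>2)"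
      by (simp add: set_lebesgue_integral_def)
    also have "\<dots> = S v - S u - 2 * c * (L v - L u) + c\<^sup>2 * (v - u)"
      using that by (intro squared_deviation_eq) auto
    also have "\<dots> = S v - S u - (L v - L u)\<^sup>2 / (v - u)"
      using that by (simp add: c_def power2_eq_square)
    finally show ?thesis by simp
  qed
  show "(L u)\<^sup>2 / u \<le> S u"
    using *[of 0 u] u by (cases "u = 0") auto
  show "(L 1 - L u)\<^sup>2 / (1 - u) \<le> S 1 - S u"
    using *[of u 1] u by (cases "u = 1") auto
qed

text \<open>Only the quotients with vanishing denominator need care. Near 0 the first lies between 0
  and \<open>S u\<close>, near 1 the second lies between 0 and \<open>S 1 - S u\<close>, and both
  bounds tend to 0.\<close>

lemma continuous_on_risk_profile: "continuous_on {0..1} W"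
proof -
  have lower: "continuous_on {0..1} (\<lambda>u. (L u)\<^sup>2 / u)"
    unfolding continuous_on_eq_continuous_within
  proof
    fix u :: real assume u: "u \<in> {0..1}"
    show "continuous (at u within {0..1}) (\<lambda>u. (L u)\<^sup>2 / u)"
    proof (cases "u = 0")
      case True
      have "(S \<longlongrightarrow> 0) (at 0 within {0..1})"
        using continuous_on_S by (force simp: continuous_on_def)
      then have "((\<lambda>u. (L u)\<^sup>2 / u) \<longlongrightarrow> 0) (at 0 within {0..1})"
        by (rule tendsto_sandwich[OF _ _ tendsto_const, rotated 2])
          (auto simp: eventually_at_filter L_square_le intro!: always_eventually)
      then show ?thesis by (simp add: True continuous_within)
    qed (use u continuous_on_L in \<open>auto intro!: continuous_intros simp: continuous_on_eq_continuous_within\<close>)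
  qed
  have upper: "continuous_on {0..1} (\<lambda>u. (L 1 - L u)\<^sup>2 / (1 - u))"
    unfolding continuous_on_eq_continuous_within
  proof
    fix u :: real assume u: "u \<in> {0..1}"
    show "continuous (at u within {0..1}) (\<lambda>u. (L 1 - L u)\<^sup>2 / (1 - u))"
    proof (cases "u = 1")
      case True
      have "((\<lambda>u. S 1 - S u) \<longlongrightarrow> S 1 - S 1) (at 1 within {0..1})"
        using continuous_on_S by (intro tendsto_intros) (force simp: continuous_on_def)
      then have lim: "((\<lambda>u. S 1 - S u) \<longlongrightarrow> 0) (at 1 within {0..1})" by simp
      have "((\<lambda>u. (L 1 - L u)\<^sup>2 / (1 - u)) \<longlongrightarrow> 0) (at 1 within {0..1})"
        by (rule tendsto_sandwich[OF _ _ tendsto_const lim])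
          (auto simp: eventually_at_filter L_complement_square_le intro!: always_eventually)
      then show ?thesis by (simp add: True continuous_within)
    qed (use u continuous_on_L in \<open>auto intro!: continuous_intros simp: continuous_on_eq_continuous_within\<close>)
  qed
  have "continuous_on {0..1} (\<lambda>u. S 1 - (L u)\<^sup>2 / u - (L 1 - L u)\<^sup>2 / (1 - u))"
    by (intro continuous_intros lower upper)
  then show ?thesis by (rule continuous_on_eq) (simp add: risk_profile_eq)
qed

section \<open>Differentiating the risk profile\<close>

text \<open>\<open>Q\<close> is monotone, so its integral lies between the end values times the
  length. Exchanging \<open>u\<close> and \<open>v\<close> flips all signs and yields the same
  inequalities, so no order of the points is required.\<close>

lemma L_increment_bounds:
  assumes "u \<in> {0<..<1}" "v \<in> {0<..<1}"
  shows "Q u * (v - u) \<le> L v - L u" "L v - L u \<le> Q v * (v - u)"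
proof -
  have *: "Q u * (v - u) \<le> L v - L u \<and> L v - L u \<le> Q v * (v - u)"
    if "u \<in> {0<..<1}" "v \<in> {0<..<1}" "u \<le> v" for u v
  proof -
    have "integral {u..v} (\<lambda>_. Q u) \<le> integral {u..v} Q" "integral {u..v} Q \<le> integral {u..v} (\<lambda>_. Q v)"
      by (intro integral_le; use that in \<open>auto intro!: quantile_integrable_on quantile_mono\<close>)+
    then show ?thesis using that by (simp add: integral_quantile mult.commute)
  qed
  show "Q u * (v - u) \<le> L v - L u" "L v - L u \<le> Q v * (v - u)"
    using *[of u v] *[of v u] assms by (cases "u \<le> v"; force simp: algebra_simps)+
qed

text \<open>The difference quotient is squeezed between the smaller and the larger of
  \<open>Q u\<close> and \<open>Q v\<close>. With \<open>T\<close> arbitrary, one statement serves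
  both for left derivatives everywhere and for derivatives at continuity points of
  \<open>Q\<close>.\<close>

lemma L_has_derivative:
  assumes u: "u \<in> {0<..<1}" and cont: "continuous (at u within T) Q"
  shows "(L has_real_derivative Q u) (at u within T)"
  unfolding has_field_derivative_iff
proof (rule tendsto_sandwich)
  have ev: "\<forall>\<^sub>F v in at u within T. v \<in> {0<..<1}" "\<forall>\<^sub>F v in at u within T. v \<noteq> u"
    using eventually_at_in_open'[of "{0<..<1}" u] u
    by (auto simp: eventually_at_filter intro: eventually_mono filter_leD[OF at_le[OF subset_UNIV]])
  have lim: "(Q \<longlongrightarrow> Q u) (at u within T)" using cont by (simp add: continuous_within)
  show "((\<lambda>v. min (Q u) (Q v)) \<longlongrightarrow> Q u) (at u within T)"
    using tendsto_min[OF tendsto_const[of "Q u"] lim] by simp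
  show "((\<lambda>v. max (Q u) (Q v)) \<longlongrightarrow> Q u) (at u within T)"
    using tendsto_max[OF tendsto_const[of "Q u"] lim] by simp
  have *: "min (Q u) (Q v) \<le> (L v - L u) / (v - u) \<and> (L v - L u) / (v - u) \<le> max (Q u) (Q v)"
    if "v \<in> {0<..<1}" "v \<noteq> u" for v
  proof (cases "u < v")
    case True
    then show ?thesis
      using L_increment_bounds[OF u that(1)] quantile_mono[OF u that(1)]
      by (simp add: min_def max_def pos_le_divide_eq pos_divide_le_eq)
  next
    case False
    with \<open>v \<noteq> u\<close> have "v < u" by simp
    then show ?thesis
      using L_increment_bounds[OF u that(1)] quantile_mono[OF that(1) u]
      by (auto simp: min_def max_def neg_le_divide_eq neg_divide_le_eq)
  qed
  show "\<forall>\<^sub>F v in at u within T. min (Q u) (Q v) \<le> (L v - L u) / (v - u)"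
    using ev by eventually_elim (use * in auto)
  show "\<forall>\<^sub>F v in at u within T. (L v - L u) / (v - u) \<le> max (Q u) (Q v)"
    using ev by eventually_elim (use * in auto)
qed

text \<open>The left derivative of \<open>W\<close> at every point of the open unit interval, and
  the negative of \<open>dev_diff\<close> composed with \<open>Q\<close> there.\<close>

definition slope :: "real \<Rightarrow> real" where
  "slope u = (Q u - lower_mean M X u)\<^sup>2 - (upper_mean M X u - Q u)\<^sup>2"

lemma risk_profile_has_derivative:
  assumes u: "u \<in> {0<..<1}" and cont: "continuous (at u within T) Q"
  shows "(W has_real_derivative slope u) (at u within T)"
proof -
  let ?w = "\<lambda>u. S 1 - (L u)\<^sup>2 / u - (L 1 - L u)\<^sup>2 / (1 - u)"
  have "(?w has_real_derivative
      - ((2 * L u * Q u) * u - (L u)\<^sup>2) / u\<^sup>2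
      - ((- 2 * (L 1 - L u) * Q u) * (1 - u) + (L 1 - L u)\<^sup>2) / (1 - u)\<^sup>2) (at u within T)"
    using u by (auto intro!: derivative_eq_intros L_has_derivative[OF u cont] simp: power2_eq_square field_simps minus_divide_left)
  also have "- ((2 * L u * Q u) * u - (L u)\<^sup>2) / u\<^sup>2
      - ((- 2 * (L 1 - L u) * Q u) * (1 - u) + (L 1 - L u)\<^sup>2) / (1 - u)\<^sup>2
    = - 2 * (L u / u) * Q u + (L u / u)\<^sup>2 + 2 * ((L 1 - L u) / (1 - u)) * Q u - ((L 1 - L u) / (1 - u))\<^sup>2"
    using u by (simp add: power2_eq_square divide_simps) (simp add: algebra_simps)
  \<comment> \<open>The squares of \<open>Q u\<close> from the two terms of \<open>slope\<close>
    cancel, leaving exactly the quotient-rule expression.\<close>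
  also have "\<dots> = slope u"
    unfolding slope_def lower_mean_eq[OF u] upper_mean_eq[OF u] by (simp add: power2_diff algebra_simps)
  finally have deriv: "(?w has_real_derivative slope u) (at u within T)" .
  have "\<forall>\<^sub>F v in nhds u. v \<in> {0<..<1}"
    using u by (intro eventually_nhds_in_open) auto
  then have "\<forall>\<^sub>F v in nhds u. W v = ?w v"
    by eventually_elim (simp add: risk_profile_eq)
  then show ?thesis
    using deriv by (subst has_field_derivative_cong_eventually) (auto simp: eventually_at_filter elim!: eventually_mono dest: eventually_nhds_x_imp_x)
qed

lemma risk_profile_left_derivative:
  assumes "0 < u" "u < 1"
  shows "(W has_real_derivative slope u) (at_left u)"
  using assms by (intro risk_profile_has_derivative quantile_left_continuous) auto

text \<open>A monotone function has only countably many discontinuities.\<close>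

lemma AE_isCont_quantile: "AE u\<in>{0<..<1} in lborel. isCont Q u"
proof -
  have "countable {u \<in> {0<..<1}. \<not> isCont Q u}"
    using mono_on_ctble_discont_open[of "{0<..<1}" Q] by (simp add: mono_on_def quantile_mono)
  then have "{u \<in> {0<..<1}. \<not> isCont Q u} \<in> null_sets lborel"
    by (rule countable_imp_null_set_lborel)
  then show ?thesis by (rule AE_I') auto
qed

lemma continuous_on_slope_parts:
  "continuous_on {0<..<1} (\<lambda>u. L u / u)" "continuous_on {0<..<1} (\<lambda>u. (L 1 - L u) / (1 - u))"
  by (intro continuous_intros continuous_on_subset[OF continuous_on_L]; auto)+

lemma slope_eq:
  assumes "u \<in> {0<..<1}"
  shows "slope u = (Q u - L u / u)\<^sup>2 - ((L 1 - L u) / (1 - u) - Q u)\<^sup>2"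
  using assms by (simp add: slope_def lower_mean_eq upper_mean_eq)

lemma slope_left_continuous:
  assumes u: "u \<in> {0<..<1}" shows "continuous (at_left u) slope"
proof -
  have c: "continuous (at_left u) L"
    using continuous_on_interior[OF continuous_on_L, of u] u by (auto intro: continuous_at_imp_continuous_at_within)
  have "continuous (at_left u) (\<lambda>u. (Q u - L u / u)\<^sup>2 - ((L 1 - L u) / (1 - u) - Q u)\<^sup>2)"
    by (intro continuous_intros c quantile_left_continuous[OF u]) (use u in auto)
  moreover have "\<forall>\<^sub>F v in at_left u. slope v = (Q v - L v / v)\<^sup>2 - ((L 1 - L v) / (1 - v) - Q v)\<^sup>2"
    unfolding eventually_at_left_field by (intro exI[of _ 0]) (use u in \<open>auto simp: slope_eq\<close>)
  ultimately show ?thesis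
    unfolding continuous_within using u by (simp add: slope_eq tendsto_cong)
qed

text \<open>On a compact subinterval \<open>Q\<close> lies between its end values and the two
  conditional means are continuous, hence bounded. So the left derivative \<open>slope\<close> is
  bounded there.\<close>

lemma risk_profile_locally_absolutely_continuous:
  "locally_absolutely_continuous_on {0<..<1} W"
  unfolding locally_absolutely_continuous_on_def
proof (intro allI impI)
  fix c d :: real assume "c \<le> d" and sub: "{c..d} \<subseteq> {0<..<1}"
  then have cd: "c \<in> {0<..<1}" "d \<in> {0<..<1}" by auto
  define m where "m = \<bar>Q c\<bar> + \<bar>Q d\<bar>"
  have "bounded ((\<lambda>x. L x / x) ` {c..d})"
    by (intro compact_imp_bounded compact_continuous_image compact_Icc
        continuous_on_subset[OF continuous_on_slope_parts(1) sub])
  then obtain p where p: "\<And>x. x \<in> {c..d} \<Longrightarrow> \<bar>L x / x\<bar> \<le> p"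
    unfolding bounded_iff ball_simps real_norm_def by blast
  have "bounded ((\<lambda>x. (L 1 - L x) / (1 - x)) ` {c..d})"
    by (intro compact_imp_bounded compact_continuous_image compact_Icc
        continuous_on_subset[OF continuous_on_slope_parts(2) sub])
  then obtain q where q: "\<And>x. x \<in> {c..d} \<Longrightarrow> \<bar>(L 1 - L x) / (1 - x)\<bar> \<le> q"
    unfolding bounded_iff ball_simps real_norm_def by blast
  show "absolutely_continuous_on_interval c d W"
  proof (rule absolutely_continuous_on_interval_left_derivative_bounded)
    show "continuous_on {c..d} W"
      using continuous_on_risk_profile by (rule continuous_on_subset) (use cd in auto)
    fix x assume x: "c < x" "x < d"
    then have x01: "x \<in> {0<..<1}" and xcd: "x \<in> {c..d}" using cd by auto
    show "(W has_real_derivative slope x) (at_left x)"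
      using x01 by (intro risk_profile_left_derivative) auto
    have "Q c \<le> Q x" "Q x \<le> Q d"
      using x x01 cd by (auto intro!: quantile_mono)
    then have "\<bar>Q x\<bar> \<le> m" by (auto simp: m_def)
    then have "\<bar>Q x - L x / x\<bar> \<le> m + p" "\<bar>(L 1 - L x) / (1 - x) - Q x\<bar> \<le> m + q"
      using p[OF xcd] q[OF xcd] by linarith+
    then have "(Q x - L x / x)\<^sup>2 \<le> (m + p)\<^sup>2" "((L 1 - L x) / (1 - x) - Q x)\<^sup>2 \<le> (m + q)\<^sup>2"
      by (metis abs_ge_zero power2_abs power_mono)+
    then show "\<bar>slope x\<bar> \<le> (m + p)\<^sup>2 + (m + q)\<^sup>2"
      unfolding slope_eq[OF x01]
      using zero_le_power2[of "Q x - L x / x"] zero_le_power2[of "(L 1 - L x) / (1 - x) - Q x"]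
      by linarith
  qed
qed

section \<open>Conditional deviations\<close>

text \<open>The quantile transform turns the event \<open>t < X\<close> into \<open>F t < v\<close>
  exactly, and the event \<open>X < t\<close> into \<open>v < F t\<close> up to the single point
  \<open>v = F t\<close>.\<close>

lemma
  fixes g :: "real \<Rightarrow> real"
  assumes [measurable]: "g \<in> borel_measurable borel"
  shows set_integral_less_eq_quantile:
      "(LINT \<omega>:{\<omega>\<in>space M. X \<omega> < t}|M. g (X \<omega>)) = (LINT v:{0<..<F t}|lborel. g (Q v))"
    and set_integral_greater_eq_quantile:
      "(LINT \<omega>:{\<omega>\<in>space M. t < X \<omega>}|M. g (X \<omega>)) = (LINT v:{F t<..<1}|lborel. g (Q v))"
proof -
  have Q_iff: "v < F t \<Longrightarrow> Q v < t" "F t < v \<Longrightarrow> t < Q v" if v: "v \<in> {0<..<1}" for v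
  proof -
    show "t < Q v" if "F t < v" using quantile_le_iff[OF v, of t] that by linarith
    show "Q v < t" if "v < F t"
      using quantile_le_iff[OF v, of t] F_quantile[OF v] that by (cases "Q v = t") auto
  qed
  have meas: "(\<lambda>v. indicator {0<..<1} v *\<^sub>R h (Q v)) \<in> borel_measurable lborel"
    if "h \<in> borel_measurable borel" for h :: "real \<Rightarrow> real"
  proof -
    have "(\<lambda>v. h (Q v)) \<in> borel_measurable (restrict_space lborel {0<..<1})"
      using quantile_borel_measurable that by (rule measurable_compose)
    then show ?thesis by (simp add: borel_measurable_restrict_space_iff)
  qed
  have "(LINT \<omega>:{\<omega>\<in>space M. X \<omega> < t}|M. g (X \<omega>)) = (\<integral>\<omega>. indicator {..<t} (X \<omega>) * g (X \<omega>) \<partial>M)"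
    unfolding set_lebesgue_integral_def by (rule Bochner_Integration.integral_cong) (auto simp: indicator_def)
  also have "\<dots> = (LINT v:{0<..<1}|lborel. indicator {..<t} (Q v) * g (Q v))"
    by (rule integral_eq_quantile) simp
  also have "\<dots> = (LINT v:{0<..<F t}|lborel. g (Q v))"
    unfolding set_lebesgue_integral_def
  proof (rule integral_cong_AE)
    \<comment> \<open>\<open>Q\<close> is known to be measurable only on the open unit interval, so
      its indicator is inserted.\<close>
    have eq: "(\<lambda>v. indicat_real {0<..<F t} v *\<^sub>R g (Q v))
        = (\<lambda>v. indicat_real {0<..<F t} v *\<^sub>R (indicat_real {0<..<1} v *\<^sub>R g (Q v)))"
      using F_bounds[of t] by (auto simp: fun_eq_iff indicator_def)
    show "(\<lambda>v. indicat_real {0<..<F t} v *\<^sub>R g (Q v)) \<in> borel_measurable lborel"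
      unfolding eq by (intro borel_measurable_scaleR meas borel_measurable_indicator) auto
    show "AE v in lborel. indicat_real {0<..<1} v *\<^sub>R (indicat_real {..<t} (Q v) * g (Q v))
        = indicat_real {0<..<F t} v *\<^sub>R g (Q v)"
      using AE_lborel_singleton[of "F t"]
    proof eventually_elim
      case (elim v)
      consider "v \<notin> {0<..<1}" | "v \<in> {0<..<1}" "v < F t" | "v \<in> {0<..<1}" "F t < v"
        using elim by fastforce
      then show ?case
      proof cases
        case 1
        then have "v \<notin> {0<..<F t}" using F_bounds[of t] by auto
        with 1 show ?thesis by simp
      qed (use Q_iff[of v] in \<open>auto simp: indicator_def\<close>)
    qed
  qed (rule meas, measurable)
  finally show "(LINT \<omega>:{\<omega>\<in>space M. X \<omega> < t}|M. g (X \<omega>)) = (LINT v:{0<..<F t}|lborel. g (Q v))" .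
  have "(LINT \<omega>:{\<omega>\<in>space M. t < X \<omega>}|M. g (X \<omega>)) = (\<integral>\<omega>. indicator {t<..} (X \<omega>) * g (X \<omega>) \<partial>M)"
    unfolding set_lebesgue_integral_def by (rule Bochner_Integration.integral_cong) (auto simp: indicator_def)
  also have "\<dots> = (LINT v:{0<..<1}|lborel. indicator {t<..} (Q v) * g (Q v))"
    by (rule integral_eq_quantile) simp
  also have "\<dots> = (LINT v:{F t<..<1}|lborel. g (Q v))"
    unfolding set_lebesgue_integral_def
  proof (rule Bochner_Integration.integral_cong)
    fix v show "indicat_real {0<..<1} v *\<^sub>R (indicat_real {t<..} (Q v) * g (Q v))
        = indicat_real {F t<..<1} v *\<^sub>R g (Q v)"
      using quantile_le_iff[of v t] F_bounds[of t]
      by (cases "v \<in> {0<..<1}") (auto simp: indicator_def)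
  qed simp
  finally show "(LINT \<omega>:{\<omega>\<in>space M. t < X \<omega>}|M. g (X \<omega>)) = (LINT v:{F t<..<1}|lborel. g (Q v))" .
qed

lemma
  shows prob_less_eq: "prob {\<omega>\<in>space M. X \<omega> < t} = F t"
    and prob_greater_eq: "prob {\<omega>\<in>space M. t < X \<omega>} = 1 - F t"
  using set_integral_less_eq_quantile[of "\<lambda>_. 1" t] set_integral_greater_eq_quantile[of "\<lambda>_. 1" t] F_bounds[of t]
  by (simp_all add: set_integral_const)

text \<open>Conditioning on the two events amounts to averaging \<open>Q\<close> below and above the
  level \<open>F t\<close>, so the deviations are the distances from \<open>t\<close> to the lower
  and upper means at that level.\<close>

lemma
  assumes t: "t \<in> J"
  shows lower_dev_eq: "lower_dev M X t = t - L (F t) / F t"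
    and upper_dev_eq: "upper_dev M X t = (L 1 - L (F t)) / (1 - F t) - t"
proof -
  have Ft: "0 < F t" "F t < 1" using F_mem_unit[OF t] by auto
  have int: "set_integrable lborel {u<..<v} Q" "set_integrable lborel {u<..<v} (\<lambda>_. t)"
    if "0 \<le> u" "u \<le> v" "v \<le> 1" for u v
  proof -
    show "set_integrable lborel {u<..<v} Q"
      using quantile_integrable by (rule set_integrable_subset) (use that in auto)
    show "set_integrable lborel {u<..<v} (\<lambda>_. t)"
      unfolding set_integrable_def using that by (intro integrable_scaleR_left integrable_real_indicator) auto
  qed
  have "(LINT v:{0<..<F t}|lborel. t - Q v) = t * F t - L (F t)"
    using int[of 0 "F t"] Ft set_integral_eq_integral_Icc[OF quantile_integrable, of 0 "F t"]
    by (simp add: set_integral_const L_def)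
  moreover have "(LINT \<omega>:{\<omega>\<in>space M. X \<omega> < t}|M. t - X \<omega>) = (LINT v:{0<..<F t}|lborel. t - Q v)"
    by (rule set_integral_less_eq_quantile) simp
  ultimately show "lower_dev M X t = t - L (F t) / F t"
    using Ft by (simp add: lower_dev_def cond_expectation_def prob_less_eq field_simps)
  have "(LINT v:{F t<..<1}|lborel. Q v - t) = L 1 - L (F t) - t * (1 - F t)"
    using int[of "F t" 1] Ft set_integral_eq_integral_Icc[OF quantile_integrable, of "F t" 1]
      integral_quantile[of "F t" 1]
    by (simp add: set_integral_const)
  moreover have "(LINT \<omega>:{\<omega>\<in>space M. t < X \<omega>}|M. X \<omega> - t) = (LINT v:{F t<..<1}|lborel. Q v - t)"
    by (rule set_integral_greater_eq_quantile) simp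
  ultimately show "upper_dev M X t = (L 1 - L (F t)) / (1 - F t) - t"
    using Ft by (simp add: upper_dev_def cond_expectation_def prob_greater_eq diff_divide_distrib)
qed

lemma lower_dev_nonneg: "0 \<le> lower_dev M X t" and upper_dev_nonneg: "0 \<le> upper_dev M X t"
  unfolding lower_dev_def upper_dev_def cond_expectation_def set_lebesgue_integral_def
  by (intro divide_nonneg_nonneg Bochner_Integration.integral_nonneg; simp add: indicator_def)+

lemma slope_eq_deviations:
  assumes "u \<in> {0<..<1}"
  shows "slope u = (lower_dev M X (Q u))\<^sup>2 - (upper_dev M X (Q u))\<^sup>2"
  using assms by (simp add: slope_eq lower_dev_eq upper_dev_eq quantile_mem_J F_quantile)

lemma dev_diff_quantile: "u \<in> {0<..<1} \<Longrightarrow> dev_diff M X (Q u) = - slope u"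
  by (simp add: dev_diff_def slope_eq_deviations)

lemma convex_risk_profile_iff_mono_slope: "convex_on {0..1} W \<longleftrightarrow> mono_on {0<..<1} slope"
  by (rule convex_on_iff_mono_left_derivative[OF continuous_on_risk_profile risk_profile_left_derivative])

lemma antimono_dev_diff_quantile_iff:
  "antimono_on {0<..<1} (\<lambda>u. dev_diff M X (Q u)) \<longleftrightarrow> mono_on {0<..<1} slope"
  by (auto simp: monotone_on_def dev_diff_quantile)

text \<open>On the open unit interval the function is \<open>- slope\<close>, which is left
  continuous, so an almost everywhere representative forces monotonicity at every point.\<close>

lemma has_nonincreasing_representative_iff_mono_slope:
  "has_nonincreasing_representative (\<lambda>u. dev_diff M X (Q u)) \<longleftrightarrow> mono_on {0<..<1} slope"
proof -
  have "continuous (at_left u) (\<lambda>u. dev_diff M X (Q u))" if u: "u \<in> {0<..<1}" for u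
  proof -
    have "\<forall>\<^sub>F v in at_left u. - slope v = dev_diff M X (Q v)"
      unfolding eventually_at_left_field by (intro exI[of _ 0]) (use u in \<open>auto simp: dev_diff_quantile\<close>)
    moreover have "continuous (at_left u) (\<lambda>v. - slope v)"
      by (intro continuous_minus slope_left_continuous u)
    ultimately show ?thesis
      unfolding continuous_within using u by (simp add: dev_diff_quantile tendsto_cong)
  qed
  then show ?thesis
    using has_nonincreasing_representative_iff antimono_dev_diff_quantile_iff by blast
qed

section \<open>Log-concave distribution functions\<close>

text \<open>The substitutions \<open>v = u * p\<close> and \<open>v = 1 - (1 - u) * p\<close> turn
  both conditional means into averages over one fixed interval, so that different levels
  \<open>u\<close> can be compared for each \<open>p\<close>.\<close>

lemma
  assumes u: "u \<in> {0<..<1}"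
  shows lower_scaled_quantile_integrable: "set_integrable lborel {0<..<1} (\<lambda>p. Q (u * p))"
    and lower_mean_eq_scaled: "(LINT p:{0<..<1}|lborel. Q (u * p)) = L u / u"
    and upper_scaled_quantile_integrable: "set_integrable lborel {0<..<1} (\<lambda>p. Q (1 - (1 - u) * p))"
    and upper_mean_eq_scaled: "(LINT p:{0<..<1}|lborel. Q (1 - (1 - u) * p)) = (L 1 - L u) / (1 - u)"
proof -
  let ?f = "\<lambda>v. indicat_real {0<..<u} v *\<^sub>R Q v" and ?g = "\<lambda>v. indicat_real {u<..<1} v *\<^sub>R Q v"
  have f: "integrable lborel ?f" and g: "integrable lborel ?g"
    unfolding set_integrable_def[symmetric]
    by (rule set_integrable_subset[OF quantile_integrable]; use u in auto)+
  have f_eq: "(\<lambda>p. ?f (0 + u * p)) = (\<lambda>p. indicat_real {0<..<1} p *\<^sub>R Q (u * p))"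
    using u by (auto simp: fun_eq_iff indicator_def zero_less_mult_iff)
  have g_eq: "(\<lambda>p. ?g (1 + (u - 1) * p)) = (\<lambda>p. indicat_real {0<..<1} p *\<^sub>R Q (1 - (1 - u) * p))"
  proof
    fix p
    have "1 + (u - 1) * p = 1 - (1 - u) * p" by (simp add: algebra_simps)
    moreover have "u < 1 - (1 - u) * p \<longleftrightarrow> 0 < (1 - u) * (1 - p)" by (simp add: algebra_simps)
    moreover have "1 - (1 - u) * p < 1 \<longleftrightarrow> 0 < (1 - u) * p" by simp
    ultimately show "?g (1 + (u - 1) * p) = indicat_real {0<..<1} p *\<^sub>R Q (1 - (1 - u) * p)"
      using u by (auto simp: indicator_def zero_less_mult_iff)
  qed
  show "set_integrable lborel {0<..<1} (\<lambda>p. Q (u * p))"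
    using lborel_integrable_real_affine[OF f, of u 0] u unfolding f_eq by (simp add: set_integrable_def)
  show "set_integrable lborel {0<..<1} (\<lambda>p. Q (1 - (1 - u) * p))"
    using lborel_integrable_real_affine[OF g, of "u - 1" 1] u unfolding g_eq by (simp add: set_integrable_def)
  have "L u = u * (LINT p:{0<..<1}|lborel. Q (u * p))"
    using lborel_integral_real_affine[of u ?f 0] u set_integral_eq_integral_Icc[OF quantile_integrable, of 0 u]
    unfolding f_eq by (simp add: set_lebesgue_integral_def L_def)
  then show "(LINT p:{0<..<1}|lborel. Q (u * p)) = L u / u"
    using u by (simp add: field_simps)
  have "L 1 - L u = (1 - u) * (LINT p:{0<..<1}|lborel. Q (1 - (1 - u) * p))"
    using lborel_integral_real_affine[of "u - 1" ?g 1] u integral_quantile[of u 1]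
      set_integral_eq_integral_Icc[OF quantile_integrable, of u 1]
    unfolding g_eq by (simp add: set_lebesgue_integral_def)
  then show "(LINT p:{0<..<1}|lborel. Q (1 - (1 - u) * p)) = (L 1 - L u) / (1 - u)"
    using u by (simp add: field_simps)
qed

text \<open>\<open>Q (F s * p)\<close> is the \<open>p\<close>-quantile of \<open>X\<close> given
  \<open>X < s\<close>. Log-concavity shows that moving the threshold from \<open>s\<close> to
  \<open>t\<close> raises it by at most \<open>t - s\<close>; averaging over \<open>p\<close> bounds
  the growth of the conditional mean by \<open>t - s\<close>.\<close>

lemma lower_dev_mono:
  assumes lc: "log_concave_on J F"
  shows "mono_on J (lower_dev M X)"
proof (rule mono_onI)
  fix s t assume s: "s \<in> J" and t: "t \<in> J" and le: "s \<le> t"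
  note Fs = F_mem_unit[OF s] and Ft = F_mem_unit[OF t]
  have "(LINT p:{0<..<1}|lborel. Q (F t * p)) \<le> (LINT p:{0<..<1}|lborel. Q (F s * p)) + (t - s)"
  proof (rule set_integral_shift_le[OF lower_scaled_quantile_integrable[OF Ft]
        lower_scaled_quantile_integrable[OF Fs]])
    fix p :: real assume p: "p \<in> {0<..<1}"
    have mem: "F s * p \<in> {0<..<1}" "F t * p \<in> {0<..<1}"
      using Fs Ft p mult_strict_mono[of "F s" 1 p 1] mult_strict_mono[of "F t" 1 p 1] by auto
    define x where "x = Q (F s * p)"
    have Fx: "F x = F s * p" unfolding x_def using mem by (rule_tac F_quantile)
    have "x \<le> s" unfolding x_def using quantile_le_iff[OF mem(1), of s] Fs p by simp
    \<comment> \<open>The four-point inequality with outer points \<open>x\<close> and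
      \<open>t\<close>, both in \<open>J\<close>. Since \<open>F x = F s * p\<close>, the factor
      \<open>F s\<close> cancels.\<close>
    then have "F x * F (s + (t - s)) \<le> F (x + (t - s)) * F s"
      using lc quantile_mem_J[OF mem(1)] t le by (intro log_concave_on_mult_le) (auto simp: x_def)
    then have "F t * p \<le> F (x + (t - s))"
      using Fs by (simp add: Fx mult.commute)
    then show "Q (F t * p) \<le> Q (F s * p) + (t - s)"
      using quantile_le_iff[OF mem(2)] by (simp add: x_def)
  qed
  then show "lower_dev M X s \<le> lower_dev M X t"
    unfolding lower_mean_eq_scaled[OF Fs] lower_mean_eq_scaled[OF Ft] by (simp add: lower_dev_eq s t)
qed

text \<open>The mirror argument for \<open>1 - F\<close>: given \<open>X > s\<close>, the point
  exceeded with conditional probability \<open>p\<close> moves by at most \<open>t - s\<close> when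
  the threshold moves to \<open>t\<close>.\<close>

lemma upper_dev_antimono:
  assumes lc: "log_concave_on J (\<lambda>t. 1 - F t)"
  shows "antimono_on J (upper_dev M X)"
proof (rule monotone_onI)
  fix s t assume s: "s \<in> J" and t: "t \<in> J" and le: "s \<le> t"
  note Fs = F_mem_unit[OF s] and Ft = F_mem_unit[OF t]
  have "(LINT p:{0<..<1}|lborel. Q (1 - (1 - F t) * p))
      \<le> (LINT p:{0<..<1}|lborel. Q (1 - (1 - F s) * p)) + (t - s)"
  proof (rule set_integral_shift_le[OF upper_scaled_quantile_integrable[OF Ft]
        upper_scaled_quantile_integrable[OF Fs]])
    fix p :: real assume p: "p \<in> {0<..<1}"
    have mem: "1 - (1 - F s) * p \<in> {0<..<1}" "1 - (1 - F t) * p \<in> {0<..<1}"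
      using Fs Ft p mult_strict_mono[of "1 - F s" 1 p 1] mult_strict_mono[of "1 - F t" 1 p 1] by auto
    define q where "q = Q (1 - (1 - F s) * p)"
    have Fq: "F q = 1 - (1 - F s) * p" unfolding q_def using mem by (rule_tac F_quantile)
    have "(1 - F s) * p < (1 - F s) * 1" using Fs p by (intro mult_strict_left_mono) auto
    then have "F s < F q" by (simp add: Fq)
    then have "s \<le> q" using F_mono[of q s] by linarith
    have "1 - (1 - F t) * p \<le> F (q + (t - s))"
    \<comment> \<open>Here the outer points are \<open>s\<close> and \<open>q + (t - s)\<close>, and
      the latter may lie beyond \<open>J\<close>; then \<open>F\<close> equals 1 there and the bound
      is immediate.\<close>
    proof (cases "q + (t - s) \<in> J")
      case True
      have "(1 - F s) * (1 - F (q + (t - s))) \<le> (1 - F (s + (t - s))) * (1 - F q)"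
        using lc s True le \<open>s \<le> q\<close> by (intro log_concave_on_mult_le) auto
      then have "(1 - F s) * (1 - F (q + (t - s))) \<le> (1 - F s) * ((1 - F t) * p)"
        by (simp add: Fq mult_ac)
      then show ?thesis using Fs by simp
    next
      case False
      have "0 < F (q + (t - s))"
        using F_mono[of q "q + (t - s)"] Fq mem le by simp
      with False have "F (q + (t - s)) = 1"
        using F_bounds[of "q + (t - s)"] by (simp add: J_set_def)
      then show ?thesis using mem by simp
    qed
    then show "Q (1 - (1 - F t) * p) \<le> Q (1 - (1 - F s) * p) + (t - s)"
      using quantile_le_iff[OF mem(2)] by (simp add: q_def)
  qed
  then show "upper_dev M X t \<le> upper_dev M X s"
    unfolding upper_mean_eq_scaled[OF Fs] upper_mean_eq_scaled[OF Ft] by (simp add: upper_dev_eq s t)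
qed

lemma antimono_dev_diff_imp_mono_slope:
  assumes "antimono_on J (dev_diff M X)"
  shows "mono_on {0<..<1} slope"
  unfolding antimono_dev_diff_quantile_iff[symmetric]
  by (rule monotone_onI) (auto intro!: monotone_onD[OF assms] quantile_mem_J quantile_mono)

lemma log_concave_imp_antimono_dev_diff:
  assumes "log_concave_on J F" "log_concave_on J (\<lambda>t. 1 - F t)"
  shows "antimono_on J (dev_diff M X)"
proof (rule monotone_onI)
  fix s t assume st: "s \<in> J" "t \<in> J" "s \<le> t"
  show "dev_diff M X t \<le> dev_diff M X s"
    unfolding dev_diff_def
    using st monotone_onD[OF lower_dev_mono[OF assms(1)], of s t]
      monotone_onD[OF upper_dev_antimono[OF assms(2)], of s t]
    by (intro diff_mono power_mono lower_dev_nonneg upper_dev_nonneg)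
qed

section \<open>Minimizers\<close>

text \<open>\<open>F\<close> is strictly below \<open>u\<close> at every point left of
  \<open>Q u\<close>, so each interval ending at \<open>Q u\<close> has positive mass. This is what
  lets a strict decrease on the support be used along \<open>Q\<close>.\<close>

lemma quantile_mem_support:
  assumes u: "u \<in> {0<..<1}"
  shows "Q u \<in> law_support M X"
  unfolding law_support_def
proof (intro CollectI allI impI)
  fix U :: "real set" assume "open U" "Q u \<in> U"
  then obtain e where e: "e > 0" "ball (Q u) e \<subseteq> U" using openE by blast
  define y where "y = Q u - e / 2"
  have "y < Q u" using e by (simp add: y_def)
  then have "F y < F (Q u)" using quantile_le_iff[OF u, of y] F_quantile[OF u] by linarith
  then have "0 < measure (distr M borel X) {y<..Q u}"
    using law.cdf_diff_eq[OF \<open>y < Q u\<close>] by (simp add: dist_fun_def)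
  also have "\<dots> \<le> measure (distr M borel X) U"
    using e \<open>open U\<close> by (intro law.finite_measure_mono) (auto simp: y_def dist_real_def subset_iff)
  finally show "0 < measure (distr M borel X) U" .
qed

text \<open>Without atoms the probability of \<open>X \<ge> m\<close> is \<open>1 - F m\<close>, so
  the two median inequalities bound \<open>F m\<close> from both sides.\<close>

lemma F_median:
  assumes "is_median M X m"
  shows "F m = 1 / 2"
proof -
  have "F m = prob {\<omega>\<in>space M. X \<omega> \<le> m}"
    by (simp add: dist_fun_def cdf_def measure_distr vimage_def Int_def conj_commute)
  moreover have "prob {\<omega>\<in>space M. m \<le> X \<omega>} = 1 - prob {\<omega>\<in>space M. X \<omega> < m}"
    using prob_compl[of "{\<omega>\<in>space M. X \<omega> < m}"]
    by (simp add: set_diff_eq not_less cong: conj_cong)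
  ultimately show ?thesis
    using assms by (simp add: is_median_def prob_less_eq)
qed

section \<open>Laws whose mean is a median\<close>

context
  assumes dev_antimono: "antimono_on J (dev_diff M X)"
    and median: "is_median M X (expectation X)"
begin

text \<open>At a median both halves have weight one half, so the mean is the midpoint of the lower
  and upper conditional means and the two deviations agree.\<close>

lemma dev_diff_mean_eq_0: "dev_diff M X (expectation X) = 0"
proof -
  have half: "F (L 1) = 1 / 2" using F_median[OF median] by (simp add: expectation_eq)
  then have "L 1 \<in> J" by (simp add: J_set_def)
  then have "upper_dev M X (expectation X) = lower_dev M X (expectation X)"
    by (simp add: upper_dev_eq lower_dev_eq expectation_eq half)
  then show ?thesis by (simp add: dev_diff_def)
qed

text \<open>\<open>Q u\<close> lies at or below the mean exactly when \<open>u \<le> 1 / 2\<close>,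
  and \<open>dev_diff\<close> is nonincreasing and vanishes at the mean.\<close>

lemma
  assumes u: "u \<in> {0<..<1}"
  shows slope_nonpos: "u \<le> 1 / 2 \<Longrightarrow> slope u \<le> 0"
    and slope_nonneg: "1 / 2 < u \<Longrightarrow> 0 \<le> slope u"
proof -
  let ?m = "expectation X"
  have m: "?m \<in> J" using F_median[OF median] by (simp add: J_set_def)
  have iff: "Q u \<le> ?m \<longleftrightarrow> u \<le> 1 / 2"
    using quantile_le_iff[OF u, of ?m] F_median[OF median] by simp
  show "slope u \<le> 0" if "u \<le> 1 / 2"
    using monotone_onD[OF dev_antimono quantile_mem_J[OF u] m] iff that u
    by (simp add: dev_diff_quantile dev_diff_mean_eq_0)
  show "0 \<le> slope u" if "1 / 2 < u"
    using monotone_onD[OF dev_antimono m quantile_mem_J[OF u]] iff that u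
    by (simp add: dev_diff_quantile dev_diff_mean_eq_0)
qed

lemma risk_profile_half_le:
  assumes u: "u \<in> {0..1}"
  shows "W (1 / 2) \<le> W u"
proof (cases "u \<le> 1 / 2")
  case True
  have "W (1 / 2) - W u \<le> 0 * (1 / 2 - u)"
    by (rule left_derivative_le_imp_increment_le[where f' = slope])
      (use True u in \<open>auto intro!: risk_profile_left_derivative slope_nonpos
        continuous_on_subset[OF continuous_on_risk_profile]\<close>)
  then show ?thesis by simp
next
  case False
  have "0 * (u - 1 / 2) \<le> W u - W (1 / 2)"
    by (rule left_derivative_ge_imp_increment_ge[where f' = slope])
      (use False u in \<open>auto intro!: risk_profile_left_derivative slope_nonneg
        continuous_on_subset[OF continuous_on_risk_profile]\<close>)
  then show ?thesis by simp
qed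

text \<open>The supporting line at a point \<open>v\<close> strictly between \<open>1 / 2\<close>
  and \<open>u\<close> has a nonzero slope pointing upwards towards \<open>u\<close>, so
  \<open>W u\<close> exceeds \<open>W v\<close>, which is at least \<open>W (1 / 2)\<close>.\<close>

lemma risk_profile_half_less:
  assumes strict: "strict_antimono_on (law_support M X \<inter> J) (dev_diff M X)"
    and u: "u \<in> {0..1}" "u \<noteq> 1 / 2"
  shows "W (1 / 2) < W u"
proof -
  \<comment> \<open>The point \<open>w\<close> lies between \<open>v\<close> and
    \<open>1 / 2\<close>. Its slope has the right weak sign, and strict monotonicity of
    \<open>slope\<close> makes the sign at \<open>v\<close> strict.\<close>
  define v w where "v = (u + 1 / 2) / 2" and "w = (v + 1 / 2) / 2"
  have vw: "v \<in> {0<..<1}" "w \<in> {0<..<1}" using u by (auto simp: v_def w_def field_simps)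
  have slope_less: "slope x < slope y" if "x \<in> {0<..<1}" "y \<in> {0<..<1}" "x < y" for x y
    using monotone_onD[OF strict, of "Q x" "Q y"] that
    by (simp add: quantile_mem_support quantile_mem_J quantile_less_iff dev_diff_quantile)
  have "0 < slope v * (u - v)"
  proof (cases "u < 1 / 2")
    case True
    then have "v < w" "w \<le> 1 / 2" "u < v" by (auto simp: v_def w_def field_simps)
    then show ?thesis
      using slope_less[OF vw] slope_nonpos[OF vw(2)] by (simp add: mult_neg_neg)
  next
    case False
    with u have "w < v" "1 / 2 < w" "v < u" by (auto simp: v_def w_def field_simps)
    then show ?thesis
      using slope_less[OF vw(2,1)] slope_nonneg[OF vw(2)] by simp
  qed
  moreover have "W v + slope v * (u - v) \<le> W u"
    using mono_left_derivative_subgradient[OF continuous_on_risk_profile risk_profile_left_derivative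
        antimono_dev_diff_imp_mono_slope[OF dev_antimono] vw(1) u(1)] by simp
  moreover have "W (1 / 2) \<le> W v"
    using vw by (intro risk_profile_half_le) auto
  ultimately show ?thesis by linarith
qed

end

lemma AE_risk_profile_derivative:
  "AE u\<in>{0<..<1} in lborel. (W has_real_derivative slope u) (at u) \<and>
     slope u = (lower_dev M X (Q u))\<^sup>2 - (upper_dev M X (Q u))\<^sup>2"
  using AE_isCont_quantile
  by eventually_elim (auto intro!: risk_profile_has_derivative slope_eq_deviations)

end

theorem theorem5p1:
  fixes M :: "'a measure" and X :: "'a \<Rightarrow> real"
  assumes "prob_space M"
    and "X \<in> borel_measurable M"
    and "integrable M (\<lambda>\<omega>. (X \<omega>)\<^sup>2)"
    and "atomless_law M X"
    and "nondegenerate_law M X"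
  shows "(locally_absolutely_continuous_on {0<..<1} (risk_profile M X) \<and>
          (AE u\<in>{0<..<1} in lborel.
             (risk_profile M X has_real_derivative
                (quantile M X u - lower_mean M X u)\<^sup>2 - (upper_mean M X u - quantile M X u)\<^sup>2) (at u) \<and>
             (quantile M X u - lower_mean M X u)\<^sup>2 - (upper_mean M X u - quantile M X u)\<^sup>2 =
                (lower_dev M X (quantile M X u))\<^sup>2 - (upper_dev M X (quantile M X u))\<^sup>2))
       \<and> (convex_on {0..1} (risk_profile M X) \<longleftrightarrow>
            has_nonincreasing_representative (\<lambda>u. dev_diff M X (quantile M X u)))
       \<and> (log_concave_on (J_set M X) (dist_fun M X) \<and>
          log_concave_on (J_set M X) (\<lambda>t. 1 - dist_fun M X t) \<longrightarrow>
            mono_on (J_set M X) (lower_dev M X) \<and>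
            antimono_on (J_set M X) (upper_dev M X) \<and>
            has_nonincreasing_representative (\<lambda>u. dev_diff M X (quantile M X u)) \<and>
            convex_on {0..1} (risk_profile M X))
       \<and> (antimono_on (J_set M X) (dev_diff M X) \<and> is_median M X (prob_space.expectation M X) \<longrightarrow>
            (\<forall>u\<in>{0..1}. risk_profile M X (1 / 2) \<le> risk_profile M X u) \<and>
            (strict_antimono_on (law_support M X \<inter> J_set M X) (dev_diff M X) \<longrightarrow>
               (\<forall>u\<in>{0..1}. u \<noteq> 1 / 2 \<longrightarrow> risk_profile M X (1 / 2) < risk_profile M X u)))"
proof -
  interpret atomless_square_integrable M X
    using assms by (simp add: atomless_square_integrable_def atomless_square_integrable_axioms_def)
  show ?thesis
    using risk_profile_locally_absolutely_continuous AE_risk_profile_derivative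
      convex_risk_profile_iff_mono_slope has_nonincreasing_representative_iff_mono_slope
      lower_dev_mono upper_dev_antimono
      antimono_dev_diff_imp_mono_slope[OF log_concave_imp_antimono_dev_diff]
      risk_profile_half_le risk_profile_half_less
    unfolding slope_def by (intro conjI impI ballI) auto
qed

end
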